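(* Let $f=y^{d}+a_{1}(x)y^{d-1}+\cdots+a_{d}(x)$ and $g=y^{b}+c_{1}(x)y^{b-1}+\cdots+c_{b}(x)$ be monic polynomials in $\mathbb{R}\{x\}[y]$, where $g$ has an isolated zero at the origin. Let $D=D_\rho(0)\subset\mathbb{R}^2$ be a closed disk centered at the origin with radius $\rho>0$ such that all the series $a_i(x)$, $c_j(x)$ converge in $D$ and $g$ has no zero in $D\setminus\{(0,0)\}$. Let $q=f/g$, let $$h''=y\left(g\frac{\partial f}{\partial x}-f\frac{\partial g}{\partial x}\right)-x\left(g\frac{\partial f}{\partial y}-f\frac{\partial g}{\partial y}\right),$$ and let $$X=\{(x,y)\in D:(x,y)\neq(0,0)\text{ and }h''(x,y)=0\}.$$ Let $L\in\mathbb{R}$. Then the limit $\lim_{(x,y)\to(0,0)}q(x,y)$ exists and equals $L$ if and only if for every $\epsilon>0$ there is $0<\delta<\rho$ such that for every $(x,y)\in X\cap D_\delta$ the inequality $|q(x,y)-L|<\epsilon$ holds.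
   Context: $\mathbb{R}\{x\}$ denotes the ring of power series in $x$ with real coefficients and positive radius of convergence. $D_\delta$ denotes the closed disk in $\mathbb{R}^2$ of radius $\delta$ centered at the origin. "$g$ has an isolated zero at the origin" means $g(0,0)=0$ and $g$ has no other real zero in some neighbourhood of the origin in $\mathbb{R}^2$. *)

theory Defs
  imports "HOL-Analysis.Analysis"
begin

definition convergent_series :: "real fps set" where
  "convergent_series = {a. fps_conv_radius a > 0}"

definition monic_convergent_poly :: "real fps poly \<Rightarrow> bool" where
  "monic_convergent_poly F \<longleftrightarrow> lead_coeff F = 1 \<and> (\<forall>i. coeff F i \<in> convergent_series)"

definition eval2 :: "real fps poly \<Rightarrow> real \<Rightarrow> real \<Rightarrow> real" where
  "eval2 F x y = poly (map_poly (\<lambda>a. eval_fps a x) F) y"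

(* Only the x-coordinate of a point enters the coefficient series. *)
definition coeffs_converge_on :: "real fps poly \<Rightarrow> (real \<times> real) set \<Rightarrow> bool" where
  "coeffs_converge_on F D \<longleftrightarrow>
     (\<forall>(x, y)\<in>D. \<forall>i. summable (\<lambda>n. fps_nth (coeff F i) n * x ^ n))"

definition isolated_zero_at_origin :: "real fps poly \<Rightarrow> bool" where
  "isolated_zero_at_origin G \<longleftrightarrow>
     eval2 G 0 0 = 0 \<and> (\<forall>\<^sub>F (x, y) in at (0, 0). eval2 G x y \<noteq> 0)"

definition dx :: "real fps poly \<Rightarrow> real \<Rightarrow> real \<Rightarrow> real" where
  "dx F x y = deriv (\<lambda>s. eval2 F s y) x"

definition dy :: "real fps poly \<Rightarrow> real \<Rightarrow> real \<Rightarrow> real" where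
  "dy F x y = deriv (\<lambda>t. eval2 F x t) y"

(* The x-derivatives may be undefined where x lies on the boundary of the interval of
   convergence.  In a closed disk on which the coefficients converge this only concerns
   points with y = 0, where they are multiplied by 0. *)
definition h2 :: "real fps poly \<Rightarrow> real fps poly \<Rightarrow> real \<Rightarrow> real \<Rightarrow> real" where
  "h2 F G x y =
     y * (eval2 G x y * dx F x y - eval2 F x y * dx G x y)
   - x * (eval2 G x y * dy F x y - eval2 F x y * dy G x y)"

definition critical_set ::
  "real fps poly \<Rightarrow> real fps poly \<Rightarrow> (real \<times> real) set \<Rightarrow> (real \<times> real) set" where
  "critical_set F G D = {(x, y). (x, y) \<in> D \<and> (x, y) \<noteq> (0, 0) \<and> h2 F G x y = 0}"

definition quot2 :: "real fps poly \<Rightarrow> real fps poly \<Rightarrow> real \<Rightarrow> real \<Rightarrow> real" where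
  "quot2 F G x y = eval2 F x y / eval2 G x y"

end

theory Submission
  imports Defs
begin

text \<open>
  On a circle of radius r < \<rho> the quotient q is a smooth function of the angle, with
  derivative - h'' / g^2. The angles at which it is maximal and minimal are therefore zeros
  of h'', so a bound for |q - L| on the critical points of the circle holds on the whole circle.
\<close>

section \<open>Evaluation, radii of convergence and the chain rule\<close>

lemma eval2_sum: "eval2 F x y = (\<Sum>i\<le>degree F. eval_fps (coeff F i) x * y ^ i)"
proof -
  let ?P = "map_poly (\<lambda>a. eval_fps a x) F"
  have "eval2 F x y = (\<Sum>i\<le>degree ?P. coeff ?P i * y ^ i)"
    by (simp add: eval2_def poly_altdef)
  \<comment> \<open>Evaluating the coefficients at x may annihilate the leading one, so the degree
    of \<open>?P\<close> can depend on x. Summing up to \<open>degree F\<close> gives one fixed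
    range, as termwise differentiation in x requires.\<close>
  also have "\<dots> = (\<Sum>i\<le>degree F. coeff ?P i * y ^ i)"
  proof (rule sum.mono_neutral_left)
    have "degree ?P \<le> degree F"
      by (rule degree_le) (simp add: coeff_map_poly coeff_eq_0)
    then show "{..degree ?P} \<subseteq> {..degree F}"
      by simp
  qed (auto simp: coeff_eq_0)
  finally show ?thesis
    by (simp add: coeff_map_poly)
qed

text \<open>The point (\<rho>, 0) lies in the closed disk, so each coefficient series converges at
  the positive number \<rho>, which bounds its radius of convergence from below.\<close>

lemma fps_conv_radius_ge_of_coeffs_converge_on:
  assumes "\<rho> > 0" "coeffs_converge_on F (cball (0, 0) \<rho>)"
  shows "fps_conv_radius (coeff F i) \<ge> ereal \<rho>"
proof -
  have "(\<rho>, 0) \<in> cball (0, 0 :: real) \<rho>"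
    using assms(1) by (simp add: dist_Pair_Pair dist_real_def)
  then have "summable (\<lambda>n. fps_nth (coeff F i) n * \<rho> ^ n)"
    using assms(2) unfolding coeffs_converge_on_def by blast
  then have "conv_radius (fps_nth (coeff F i)) \<ge> norm \<rho>"
    by (rule conv_radius_geI)
  with assms(1) show ?thesis
    by (simp add: fps_conv_radius_def)
qed

lemma eval_fps_has_derivative:
  fixes a :: "real fps"
  assumes "\<bar>x\<bar> < \<rho>" "fps_conv_radius a \<ge> ereal \<rho>"
  shows "(eval_fps a has_real_derivative eval_fps (fps_deriv a) x) (at x)"
proof (rule has_field_derivative_eval_fps)
  have "ereal (norm x) < ereal \<rho>"
    using assms(1) by simp
  then show "ereal (norm x) < fps_conv_radius a"
    using assms(2) by (rule less_le_trans)
qed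

text \<open>\<open>dx\<close> and \<open>dy\<close> only differentiate along coordinate lines, so
  the rule is derived from the explicit sum: its coefficients are differentiable at
  \<open>u t\<close>, a point strictly inside their interval of convergence.\<close>

lemma eval2_chain_rule:
  fixes u v :: "real \<Rightarrow> real"
  assumes conv: "\<And>i. fps_conv_radius (coeff F i) \<ge> ereal \<rho>" and "\<bar>u t\<bar> < \<rho>"
    and u: "(u has_real_derivative u') (at t)" and v: "(v has_real_derivative v') (at t)"
  shows "((\<lambda>s. eval2 F (u s) (v s)) has_real_derivative
    u' * dx F (u t) (v t) + v' * dy F (u t) (v t)) (at t)"
proof -
  define A where "A = (\<Sum>i\<le>degree F. eval_fps (fps_deriv (coeff F i)) (u t) * v t ^ i)"
  define B where "B = (\<Sum>i\<le>degree F. eval_fps (coeff F i) (u t) * (of_nat i * v t ^ (i - 1)))"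
  \<comment> \<open>\<open>A\<close> and \<open>B\<close> are the termwise partial derivatives.
    Allowing any curve through (\<open>u t\<close>, \<open>v t\<close>) lets one computation serve
    three times: the two coordinate lines identify \<open>A\<close> with \<open>dx\<close> and
    \<open>B\<close> with \<open>dy\<close>, and the given curve yields the claim.\<close>
  have chain: "((\<lambda>s. eval2 F (p s) (w s)) has_real_derivative p' * A + w' * B) (at s0)"
    if "(p has_real_derivative p') (at s0)" "(w has_real_derivative w') (at s0)"
      "p s0 = u t" "w s0 = v t" for p w :: "real \<Rightarrow> real" and p' w' s0
  proof -
    have "((\<lambda>s. eval_fps (coeff F i) (p s)) has_real_derivative
        eval_fps (fps_deriv (coeff F i)) (u t) * p') (at s0)" for i
      using DERIV_chain2[OF _ that(1), of "eval_fps (coeff F i)"]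
        eval_fps_has_derivative[OF assms(2) conv] that(3) by simp
    note d = this
    show ?thesis
      unfolding eval2_sum A_def B_def
      by (rule derivative_eq_intros d that refl)+
        (simp add: that(3,4) sum_distrib_left sum.distrib algebra_simps)
  qed
  have "dx F (u t) (v t) = A"
    unfolding dx_def using chain[of "\<lambda>s. s" 1 "u t" "\<lambda>_. v t" 0]
    by (auto intro!: DERIV_imp_deriv)
  moreover have "dy F (u t) (v t) = B"
    unfolding dy_def using chain[of "\<lambda>_. u t" 0 "v t" "\<lambda>s. s" 1]
    by (auto intro!: DERIV_imp_deriv)
  ultimately show ?thesis
    using chain[OF u v] by simp
qed

section \<open>The quotient along a circle\<close>

lemma quot2_angular_derivative:
  fixes r t :: real
  defines "x \<equiv> r * cos t" and "y \<equiv> r * sin t"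
  assumes "\<And>i. fps_conv_radius (coeff F i) \<ge> ereal \<rho>"
    and "\<And>i. fps_conv_radius (coeff G i) \<ge> ereal \<rho>"
    and "0 < r" "r < \<rho>" "eval2 G x y \<noteq> 0"
  shows "((\<lambda>s. quot2 F G (r * cos s) (r * sin s)) has_real_derivative
    - h2 F G x y / (eval2 G x y)\<^sup>2) (at t)"
proof -
  \<comment> \<open>The strict bound r < \<rho> keeps the abscissa away from -\<rho> and \<rho>,
    where the coefficients might fail to be differentiable.\<close>
  have "\<bar>r * cos t\<bar> \<le> r"
    using assms(5) by (simp add: abs_mult mult_left_le)
  then have x: "\<bar>r * cos t\<bar> < \<rho>"
    using assms(6) by simp
  have c: "((\<lambda>s. r * cos s) has_real_derivative - y) (at t)"
    and s: "((\<lambda>s. r * sin s) has_real_derivative x) (at t)"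
    unfolding x_def y_def by (auto intro!: derivative_eq_intros)
  have F: "((\<lambda>s. eval2 F (r * cos s) (r * sin s)) has_real_derivative
      - y * dx F x y + x * dy F x y) (at t)"
    using eval2_chain_rule[OF assms(3) x c s] by (simp add: x_def y_def)
  have G: "((\<lambda>s. eval2 G (r * cos s) (r * sin s)) has_real_derivative
      - y * dx G x y + x * dy G x y) (at t)"
    using eval2_chain_rule[OF assms(4) x c s] by (simp add: x_def y_def)
  \<comment> \<open>The circle is traversed with velocity (-y, x), so the numerator of the quotient
    rule is g (x f_y - y f_x) - f (x g_y - y g_x), which is - \<open>h2\<close>.\<close>
  show ?thesis
    unfolding quot2_def h2_def
    by (rule DERIV_cong[OF DERIV_divide[OF F G]])
      (use assms(7) in \<open>simp_all add: x_def y_def power2_eq_square algebra_simps\<close>)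
qed

text \<open>By \<open>range\<close>, extrema over the compact interval are extrema over the whole
  line. Hence the derivative vanishes there even if they are attained at an end point of the
  interval.\<close>

lemma periodic_differentiable_attains_extrema:
  fixes \<phi> \<phi>' :: "real \<Rightarrow> real"
  assumes deriv: "\<And>t. (\<phi> has_real_derivative \<phi>' t) (at t)"
    and range: "\<And>t. \<exists>s\<in>{0..2 * pi}. \<phi> s = \<phi> t"
  obtains a b where "\<phi>' a = 0" "\<phi>' b = 0" "\<And>t. \<phi> a \<le> \<phi> t" "\<And>t. \<phi> t \<le> \<phi> b"
proof -
  have cont: "continuous_on {0..2 * pi} \<phi>"
    by (intro continuous_at_imp_continuous_on ballI DERIV_isCont[OF deriv])
  have ne: "{0..2 * pi} \<noteq> {}"
    by simp
  obtain a where "\<And>t. t \<in> {0..2 * pi} \<Longrightarrow> \<phi> a \<le> \<phi> t"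
    using continuous_attains_inf[OF compact_Icc ne cont] by blast
  then have a: "\<phi> a \<le> \<phi> t" for t
    by (metis range)
  obtain b where "\<And>t. t \<in> {0..2 * pi} \<Longrightarrow> \<phi> t \<le> \<phi> b"
    using continuous_attains_sup[OF compact_Icc ne cont] by blast
  then have b: "\<phi> t \<le> \<phi> b" for t
    by (metis range)
  show ?thesis
  proof
    show "\<phi>' a = 0"
      by (rule DERIV_local_min[OF deriv zero_less_one]) (simp add: a)
    show "\<phi>' b = 0"
      by (rule DERIV_local_max[OF deriv zero_less_one]) (simp add: b)
  qed (fact a b)+
qed

section \<open>Polar coordinates and critical values on a circle\<close>

lemma circle_angle:
  fixes x y :: real
  obtains t where "t \<in> {0..2 * pi}"
    "x = norm (x, y) * cos t" "y = norm (x, y) * sin t"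
proof (cases "(x, y) = (0, 0)")
  case True
  then show ?thesis
    using that[of 0] by simp
next
  case False
  define r where "r = norm (x, y)"
  have r: "r > 0" "r\<^sup>2 = x\<^sup>2 + y\<^sup>2"
    using False by (auto simp: r_def norm_Pair sum_power2_gt_zero_iff)
  then have "(x / r)\<^sup>2 + (y / r)\<^sup>2 = 1"
    by (metis add_divide_distrib divide_self less_irrefl power_divide power_not_zero)
  then obtain t where t: "0 \<le> t" "t < 2 * pi" "x / r = cos t" "y / r = sin t"
    using sincos_total_2pi by metis
  show ?thesis
  proof (rule that)
    show "t \<in> {0..2 * pi}"
      using t by simp
    show "x = norm (x, y) * cos t" "y = norm (x, y) * sin t"
      using r(1) by (simp_all flip: r_def t(3,4))
  qed
qed

lemma norm_polar:
  fixes r t :: real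
  assumes "r \<ge> 0"
  shows "norm (r * cos t, r * sin t) = r"
proof -
  have "(r * cos t)\<^sup>2 + (r * sin t)\<^sup>2 = r\<^sup>2 * ((cos t)\<^sup>2 + (sin t)\<^sup>2)"
    by (simp only: power_mult_distrib distrib_left)
  then show ?thesis
    using assms by (simp add: norm_Pair)
qed

text \<open>This carries bounds on q from critical points to all other points: the witnesses are a
  minimum and a maximum of q on the circle through (x, y). The equal norms put them into every disk
  about the origin that contains (x, y).\<close>

lemma quot2_between_critical_values:
  fixes x y \<rho> :: real
  assumes "coeffs_converge_on F (cball (0, 0) \<rho>)" "coeffs_converge_on G (cball (0, 0) \<rho>)"
    and nz: "\<forall>(x, y) \<in> cball (0, 0) \<rho> - {(0, 0)}. eval2 G x y \<noteq> 0"
    and "(x, y) \<noteq> (0, 0)" "norm (x, y) < \<rho>"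
  obtains x1 y1 x2 y2 where
    "(x1, y1) \<in> critical_set F G (cball (0, 0) \<rho>)" "norm (x1, y1) = norm (x, y)"
    "(x2, y2) \<in> critical_set F G (cball (0, 0) \<rho>)" "norm (x2, y2) = norm (x, y)"
    "quot2 F G x1 y1 \<le> quot2 F G x y" "quot2 F G x y \<le> quot2 F G x2 y2"
proof -
  define r where "r = norm (x, y)"
  have r: "0 < r" "r < \<rho>"
    using assms(4,5) by (simp_all add: r_def zero_prod_def)
  define X Y where "X = (\<lambda>t. r * cos t)" and "Y = (\<lambda>t. r * sin t)"
  have norm_XY: "norm (X t, Y t) = r" for t
    using norm_polar r by (simp add: X_def Y_def)
  have XY: "(X t, Y t) \<in> cball (0, 0) \<rho> - {(0, 0)}" for t
  proof -
    have "dist (0, 0) (X t, Y t) = r"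
      using norm_XY[of t] by (simp add: dist_norm norm_Pair)
    moreover have "(X t, Y t) \<noteq> (0, 0)"
      using norm_XY[of t] r(1) by auto
    ultimately show ?thesis
      using r by simp
  qed
  have G: "eval2 G (X t) (Y t) \<noteq> 0" for t
    using nz XY[of t] by blast
  define \<phi> where "\<phi> = (\<lambda>t. quot2 F G (X t) (Y t))"
  define \<phi>' where "\<phi>' = (\<lambda>t. - h2 F G (X t) (Y t) / (eval2 G (X t) (Y t))\<^sup>2)"
  have "\<rho> > 0"
    using r by simp
  note conv = fps_conv_radius_ge_of_coeffs_converge_on[OF this]
  have deriv: "(\<phi> has_real_derivative \<phi>' t) (at t)" for t
    using quot2_angular_derivative[OF conv[OF assms(1)] conv[OF assms(2)] r] G[of t]
    unfolding \<phi>_def \<phi>'_def X_def Y_def by blast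
  \<comment> \<open>No periodicity is invoked: the point at angle t also has an angle in [0, 2 pi],
    and the value of \<open>\<phi>\<close> depends only on the point.\<close>
  have "\<exists>s\<in>{0..2 * pi}. \<phi> s = \<phi> t" for t
  proof -
    obtain s where "s \<in> {0..2 * pi}" "X t = r * cos s" "Y t = r * sin s"
      using circle_angle[of "X t" "Y t"] norm_XY[of t] by metis
    then show ?thesis
      unfolding \<phi>_def by (metis X_def Y_def)
  qed
  then obtain a b where ab: "\<phi>' a = 0" "\<phi>' b = 0" "\<And>t. \<phi> a \<le> \<phi> t" "\<And>t. \<phi> t \<le> \<phi> b"
    using periodic_differentiable_attains_extrema[OF deriv] by metis
  \<comment> \<open>Since g does not vanish on the circle, a zero of \<open>\<phi>'\<close> is a
    zero of \<open>h2\<close> and not an artefact of division by zero.\<close>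
  have crit: "(X t, Y t) \<in> critical_set F G (cball (0, 0) \<rho>)" if "\<phi>' t = 0" for t
    using that XY[of t] G[of t] by (simp add: critical_set_def \<phi>'_def)
  obtain s where "x = X s" "y = Y s"
    using circle_angle[of x y] by (metis X_def Y_def r_def)
  then have "quot2 F G x y = \<phi> s"
    by (simp add: \<phi>_def)
  then show ?thesis
    using that[OF crit[OF ab(1)] _ crit[OF ab(2)]] norm_XY ab(3,4)[of s]
    by (simp add: \<phi>_def flip: r_def)
qed

section \<open>The limit criterion\<close>

theorem proposition2:
  fixes f g :: "real fps poly" and \<rho> L :: real
  assumes "monic_convergent_poly f"
    and "monic_convergent_poly g"
    and "isolated_zero_at_origin g"
    and "\<rho> > 0"
    and "coeffs_converge_on f (cball (0, 0) \<rho>)"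
    and "coeffs_converge_on g (cball (0, 0) \<rho>)"
    and "\<forall>(x, y) \<in> cball (0, 0) \<rho> - {(0, 0)}. eval2 g x y \<noteq> 0"
  shows "((\<lambda>(x, y). quot2 f g x y) \<longlongrightarrow> L) (at (0, 0)) \<longleftrightarrow>
    (\<forall>\<epsilon>>0. \<exists>\<delta>. 0 < \<delta> \<and> \<delta> < \<rho> \<and>
       (\<forall>(x, y) \<in> critical_set f g (cball (0, 0) \<rho>) \<inter> cball (0, 0) \<delta>.
          \<bar>quot2 f g x y - L\<bar> < \<epsilon>))"
    (is "?lim \<longleftrightarrow> ?crit")
proof
  assume ?lim
  show ?crit
  proof (intro allI impI)
    fix \<epsilon> :: real
    assume "\<epsilon> > 0"
    then obtain d where d: "d > 0"
      "\<And>p. p \<noteq> (0, 0) \<Longrightarrow> dist p (0, 0) < d \<Longrightarrow> dist (case p of (x, y) \<Rightarrow> quot2 f g x y) L < \<epsilon>"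
      using \<open>?lim\<close> unfolding LIM_def by metis
    \<comment> \<open>Halving makes \<delta> strictly smaller than both bounds; \<delta> < d is
      needed because the disk is closed while the limit estimate covers only distances below
      d.\<close>
    define \<delta> where "\<delta> = min d \<rho> / 2"
    have \<delta>: "0 < \<delta>" "\<delta> < \<rho>" "\<delta> < d"
      using d(1) assms(4) by (auto simp: \<delta>_def)
    have "\<bar>quot2 f g x y - L\<bar> < \<epsilon>"
      if "(x, y) \<in> critical_set f g (cball (0, 0) \<rho>) \<inter> cball (0, 0) \<delta>" for x y
      using that d(2)[of "(x, y)"] \<delta>(3)
      by (auto simp: critical_set_def dist_real_def dist_commute)
    with \<delta> show "\<exists>\<delta>. 0 < \<delta> \<and> \<delta> < \<rho> \<and>
       (\<forall>(x, y) \<in> critical_set f g (cball (0, 0) \<rho>) \<inter> cball (0, 0) \<delta>.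
          \<bar>quot2 f g x y - L\<bar> < \<epsilon>)"
      by blast
  qed
next
  assume crit: ?crit
  show ?lim
    unfolding LIM_def
  proof (intro allI impI)
    fix \<epsilon> :: real
    assume "\<epsilon> > 0"
    then obtain \<delta> where \<delta>: "0 < \<delta>" "\<delta> < \<rho>" and
      bound: "\<forall>(x, y) \<in> critical_set f g (cball (0, 0) \<rho>) \<inter> cball (0, 0) \<delta>.
        \<bar>quot2 f g x y - L\<bar> < \<epsilon>"
      using crit by metis
    have in_cball: "p \<in> cball (0, 0) \<delta> \<longleftrightarrow> norm p \<le> \<delta>" for p :: "real \<times> real"
      by (simp flip: zero_prod_def)
    have "\<bar>quot2 f g x y - L\<bar> < \<epsilon>" if ne: "(x, y) \<noteq> (0, 0)" and less: "norm (x, y) < \<delta>" for x y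
    proof -
      have "norm (x, y) < \<rho>"
        using less \<delta>(2) by simp
      then obtain x1 y1 x2 y2 where
        1: "(x1, y1) \<in> critical_set f g (cball (0, 0) \<rho>)" "norm (x1, y1) = norm (x, y)" and
        2: "(x2, y2) \<in> critical_set f g (cball (0, 0) \<rho>)" "norm (x2, y2) = norm (x, y)" and
        q: "quot2 f g x1 y1 \<le> quot2 f g x y" "quot2 f g x y \<le> quot2 f g x2 y2"
        using quot2_between_critical_values[OF assms(5-7) ne] by blast
      \<comment> \<open>Both critical points lie on the circle through (x, y), hence within reach of
        \<open>bound\<close>. A value between two numbers \<epsilon>-close to L is itself
        \<epsilon>-close to L.\<close>
      have "(x1, y1) \<in> cball (0, 0) \<delta>" "(x2, y2) \<in> cball (0, 0) \<delta>"
        using 1(2) 2(2) less by (simp_all only: in_cball)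
      then have "\<bar>quot2 f g x1 y1 - L\<bar> < \<epsilon>" "\<bar>quot2 f g x2 y2 - L\<bar> < \<epsilon>"
        using bound 1(1) 2(1) by blast+
      with q show ?thesis
        by linarith
    qed
    then have "dist (case p of (x, y) \<Rightarrow> quot2 f g x y) L < \<epsilon>"
      if "p \<noteq> (0, 0)" "dist p (0, 0) < \<delta>" for p
      using that by (cases p) (simp add: dist_real_def flip: zero_prod_def)
    with \<delta>(1) show "\<exists>s>0. \<forall>p. p \<noteq> (0, 0) \<and> dist p (0, 0) < s \<longrightarrow>
        dist (case p of (x, y) \<Rightarrow> quot2 f g x y) L < \<epsilon>"
      by blast
  qed
qed

end
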